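(* Let $n\ge 2$ and $1\le k\le n-1$, and let $Q_{n,k}$ be the enhanced hypercube. Then the Kirchhoff index of $Q_{n,k}$ is \[Kf(Q_{n, k})=\begin{cases} 2^{n-1}\sum\limits_{t=0}^{n}\sum\limits_{j=0}^{n}\frac{1}{t+1}{n-k+2\choose 2j}{k-1\choose t+1-2j} &\text{if } n\equiv k \pmod 2,\\[2mm] 2^{n-1}\sum\limits_{t=0}^{n-1}\sum\limits_{j=0}^{n}\frac{1}{t+1}{n-k+2\choose 2j}{k-1\choose t+1-2j} &\text{if } n\not\equiv k \pmod 2. \end{cases}\]
   Context: For $n\ge 2$ and $1\le k\le n-1$, the enhanced hypercube $Q_{n,k}$ is the simple graph whose vertices are the binary strings $x_1x_2\cdots x_n$ ($x_i\in\{0,1\}$), where $X=x_1\cdots x_n$ and $Y$ are adjacent iff either $Y$ is obtained from $X$ by complementing exactly one coordinate $x_i$ ($1\le i\le n$), or $Y=x_1\cdots x_{k-1}\overline{x_k}\,\overline{x_{k+1}}\cdots\overline{x_n}$ (complementing all coordinates $k,\dots,n$). Equivalently, $Q_{n,k}$ is the Cayley graph $\mathrm{Cay}(\mathbb{Z}_2^n,S)$ with $S=\{e_1,\dots,e_n,\epsilon_k\}$, where $e_i$ are the standard basis vectors and $\epsilon_k=e_k+e_{k+1}+\cdots+e_n$. For a connected graph $\Gamma$, the resistance distance $r_{ij}$ between vertices $v_i,v_j$ is the effective resistance between them when every edge is a unit resistor, and the Kirchhoff index is $Kf(\Gamma)=\sum_{i<j} r_{ij}$. Binomial coefficients ${a\choose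 b}$ are taken to be $0$ when $b<0$ or $b>a$. *)

theory Defs
  imports Complex_Main "HOL-Number_Theory.Cong" "HOL-Library.List_Lexorder"
    "Graph_Theory.Graph_Theory"
begin

text \<open>
  A simple graph is a symmetric loop-free \<^typ>\<open>'a pair_pre_digraph\<close> (\<^const>\<open>pair_graph\<close>): each
  undirected edge is represented by its two arcs.
\<close>

text \<open>
  Coordinates of a binary string are numbered from 1 in the mathematics and from 0 in lists, so
  $x_i$ is \<open>x ! (i - 1)\<close>.
\<close>

definition flip_coord :: "nat \<Rightarrow> bool list \<Rightarrow> bool list" where
  "flip_coord i x = x[i - 1 := \<not> x ! (i - 1)]"

definition flip_from :: "nat \<Rightarrow> bool list \<Rightarrow> bool list" where
  "flip_from k x = take (k - 1) x @ map Not (drop (k - 1) x)"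

definition enhanced_hypercube :: "nat \<Rightarrow> nat \<Rightarrow> bool list pair_pre_digraph" where
  "enhanced_hypercube n k =
     \<lparr> pverts = {x. length x = n},
       parcs = {(x, y). length x = n \<and> length y = n \<and>
                  ((\<exists>i\<in>{1..n}. y = flip_coord i x) \<or> y = flip_from k x)} \<rparr>"

lemma pair_graph_enhanced_hypercube:
  assumes "1 \<le> k" "k \<le> n"
  shows "pair_graph (enhanced_hypercube n k)"
proof -
  let ?G = "enhanced_hypercube n k"
  have fin: "finite {x :: bool list. length x = n}"
    using finite_lists_length_eq[of "UNIV :: bool set" n] by simp
  have "finite ({x :: bool list. length x = n} \<times> {x :: bool list. length x = n})"
    using fin by simp
  then have fin2: "finite (parcs ?G)"
    by (rule rev_finite_subset) (auto simp: enhanced_hypercube_def)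
  have flip_coord_inv: "flip_coord i (flip_coord i x) = x" if "i \<in> {1..n}" "length x = n" for i x
  proof -
    have "i - 1 < length x" using that by auto
    then show ?thesis by (simp add: flip_coord_def)
  qed
  have flip_from_inv: "flip_from k (flip_from k x) = x" if "length x = n" for x
    using that assms by (simp add: flip_from_def min_def comp_def)
  have flip_coord_neq: "flip_coord i x \<noteq> x" if "i \<in> {1..n}" "length x = n" for i x
  proof
    assume "flip_coord i x = x"
    then have "flip_coord i x ! (i - 1) = x ! (i - 1)" by simp
    moreover have "i - 1 < length x" using that by auto
    ultimately show False by (simp add: flip_coord_def)
  qed
  have flip_from_neq: "flip_from k x \<noteq> x" if "length x = n" for x
  proof
    assume "flip_from k x = x"
    then have "flip_from k x ! (k - 1) = x ! (k - 1)" by simp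
    moreover have "k - 1 < length x" using that assms by auto
    ultimately show False by (simp add: flip_from_def nth_append)
  qed
  have sym: "sym (parcs ?G)"
  proof (rule symI)
    fix x y assume xy: "(x, y) \<in> parcs ?G"
    then have len: "length x = n" "length y = n" by (auto simp: enhanced_hypercube_def)
    from xy consider i where "i \<in> {1..n}" "y = flip_coord i x" | "y = flip_from k x"
      unfolding enhanced_hypercube_def by auto
    then have "(\<exists>i\<in>{1..n}. x = flip_coord i y) \<or> x = flip_from k y"
      using flip_coord_inv flip_from_inv len by metis
    then show "(y, x) \<in> parcs ?G" using len by (simp add: enhanced_hypercube_def)
  qed
  show ?thesis
  proof
    show "e \<in> parcs ?G \<Longrightarrow> fst e \<in> pverts ?G" for e by (auto simp: enhanced_hypercube_def)
    show "e \<in> parcs ?G \<Longrightarrow> snd e \<in> pverts ?G" for e by (auto simp: enhanced_hypercube_def)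
    show "finite (pverts ?G)" using fin by (simp add: enhanced_hypercube_def)
    show "finite (parcs ?G)" by (rule fin2)
    show "e \<in> parcs ?G \<Longrightarrow> fst e \<noteq> snd e" for e
      using flip_coord_neq flip_from_neq by (fastforce simp: enhanced_hypercube_def)
    show "symmetric (with_proj ?G)"
      using sym by (simp add: symmetric_def)
  qed
qed

text \<open>
  Every edge is a unit resistor, so by Ohm's law the current along the arc \<open>(x, y)\<close> is
  \<open>v x - v y\<close>. Kirchhoff's current law then says that \<open>v\<close> is the potential when a unit current
  enters at \<open>a\<close> and leaves at \<open>b\<close>. For a finite connected graph, \<open>v\<close> is unique up to an additive
  constant, so \<open>v a - v b\<close> is well defined.
\<close>

definition unit_current_potential :: "'a pair_pre_digraph \<Rightarrow> 'a \<Rightarrow> 'a \<Rightarrow> ('a \<Rightarrow> real) \<Rightarrow> bool" where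
  "unit_current_potential G a b v \<longleftrightarrow>
     (\<forall>x\<in>pverts G. (\<Sum>y | (x, y) \<in> parcs G. v x - v y) =
        (if x = a then 1 else 0) - (if x = b then 1 else 0))"

definition resistance_distance :: "'a pair_pre_digraph \<Rightarrow> 'a \<Rightarrow> 'a \<Rightarrow> real" where
  "resistance_distance G a b = (THE r. \<exists>v. unit_current_potential G a b v \<and> r = v a - v b)"

text \<open>
  The linear order on the vertex type serves only to enumerate each unordered pair of distinct
  vertices once; for \<^typ>\<open>bool list\<close> it is the lexicographic order.
\<close>

definition kirchhoff_index :: "'a :: linorder pair_pre_digraph \<Rightarrow> real" where
  "kirchhoff_index G =
     (\<Sum>(a, b) | a \<in> pverts G \<and> b \<in> pverts G \<and> a < b. resistance_distance G a b)"

text \<open>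
  Integer arguments are needed because the lower index may be negative; truncated subtraction on
  \<^typ>\<open>nat\<close> would turn such a coefficient into 1.
\<close>

definition binom :: "int \<Rightarrow> int \<Rightarrow> nat" where
  "binom a b = (if 0 \<le> b \<and> b \<le> a then nat a choose nat b else 0)"

end

theory Submission
  imports Defs
begin

text \<open>
  The characters \<open>x \<mapsto> \<Prod>i\<in>U. (-1)^x\<^sub>i\<close> for \<open>U \<subseteq> {0..<n}\<close> diagonalise the Laplacian. With \<open>a\<close> the
  number of elements of \<open>U\<close> among the first \<open>k - 1\<close> coordinates and \<open>b\<close> the number among the
  remaining \<open>n - k + 1\<close>, the eigenvalue is \<open>2 (a + 2 \<lceil>b/2\<rceil>)\<close>: each element contributes 2, and the
  extra generator contributes 2 exactly if \<open>b\<close> is odd. The Kirchhoff index is the number of vertices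
  times the sum of the reciprocals of the nonzero eigenvalues. Pascal's rule merges the subsets with
  \<open>b = 2j\<close> and \<open>b = 2j - 1\<close> into the coefficient \<open>(n - k + 2) choose 2j\<close>.
\<close>

section \<open>Kirchhoff index and Laplacian spectrum\<close>

text \<open>On a finite simple graph this is degree minus adjacency, acting on functions: the net
  current leaving \<open>x\<close> under the potential \<open>f\<close>.\<close>

definition laplacian :: "'a pair_pre_digraph \<Rightarrow> ('a \<Rightarrow> real) \<Rightarrow> 'a \<Rightarrow> real" where
  "laplacian G f x = (\<Sum>y | (x, y) \<in> parcs G. f x - f y)"

lemma unit_current_potential_iff:
  "unit_current_potential G a b v \<longleftrightarrow>
     (\<forall>x\<in>pverts G. laplacian G v x = (if x = a then 1 else 0) - (if x = b then 1 else 0))"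
  by (simp add: unit_current_potential_def laplacian_def)

lemma laplacian_scale: "laplacian G (\<lambda>x. c * f x) x = c * laplacian G f x"
  by (simp add: laplacian_def sum_distrib_left right_diff_distrib)

lemma laplacian_sum: "laplacian G (\<lambda>x. \<Sum>i\<in>I. f i x) x = (\<Sum>i\<in>I. laplacian G (f i) x)"
  unfolding laplacian_def by (subst sum.swap) (simp add: sum_subtractf)

context pair_graph
begin

lemma finite_successors: "finite {y. (x, y) \<in> parcs G}"
  by (rule finite_subset[OF _ finite_imageI[OF pair_finite_arcs, of snd]]) force

text \<open>Written over arcs, the left side is the sum of \<open>g x * f x\<close>, symmetric in
  \<open>f\<close> and \<open>g\<close>, minus a cross term \<open>g x * f y\<close>, which
  reversing every arc shows to be symmetric too.\<close>

lemma laplacian_self_adjoint: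
  "(\<Sum>x\<in>pverts G. g x * laplacian G f x) = (\<Sum>x\<in>pverts G. f x * laplacian G g x)"
proof -
  have arcs: "(\<Sum>x\<in>pverts G. g x * laplacian G f x) =
      (\<Sum>(x, y)\<in>parcs G. g x * f x) - (\<Sum>(x, y)\<in>parcs G. g x * f y)" for f g
  proof -
    have "(\<Sum>x\<in>pverts G. g x * laplacian G f x) =
        (\<Sum>x\<in>pverts G. \<Sum>y | (x, y) \<in> parcs G. g x * (f x - f y))"
      by (simp add: laplacian_def sum_distrib_left)
    also have "\<dots> = (\<Sum>(x, y)\<in>(SIGMA x:pverts G. {y. (x, y) \<in> parcs G}). g x * (f x - f y))"
      by (rule sum.Sigma) (auto simp: finite_successors)
    also have "(SIGMA x:pverts G. {y. (x, y) \<in> parcs G}) = parcs G"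
      by (auto intro: in_arcsD1)
    finally show ?thesis
      by (simp add: case_prod_beta' right_diff_distrib sum_subtractf)
  qed
  have "(\<Sum>(x, y)\<in>parcs G. g x * f y) = (\<Sum>(x, y)\<in>parcs G. f x * g y)"
    by (rule sum.reindex_bij_witness[of _ prod.swap prod.swap])
       (auto intro: arcs_symmetric)
  then show ?thesis
    by (simp add: arcs mult.commute)
qed

text \<open>Reciprocity: pairing \<open>laplacian G v\<close> with any \<open>w\<close> reads off
  \<open>w a - w b\<close>, and self-adjointness exchanges the two potentials. This gives the
  uniqueness that the definite description in \<open>resistance_distance\<close> requires.\<close>

lemma unit_current_potential_drop_eq:
  assumes "unit_current_potential G a b v" "unit_current_potential G a b w"
    and "a \<in> pverts G" "b \<in> pverts G"
  shows "v a - v b = w a - w b"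
proof -
  have drop: "(\<Sum>x\<in>pverts G. w x * laplacian G v x) = w a - w b"
    if "unit_current_potential G a b v" for v w
  proof -
    have "(\<Sum>x\<in>pverts G. w x * laplacian G v x) =
        (\<Sum>x\<in>pverts G. (if x = a then w x else 0) - (if x = b then w x else 0))"
      using that by (intro sum.cong) (auto simp: unit_current_potential_iff)
    then show ?thesis
      using assms(3,4) by (simp add: sum_subtractf)
  qed
  show ?thesis
    using drop[OF assms(1), of w] drop[OF assms(2), of v] laplacian_self_adjoint[of w v] by simp
qed

lemma resistance_distance_eq:
  assumes "unit_current_potential G a b v" "a \<in> pverts G" "b \<in> pverts G"
  shows "resistance_distance G a b = v a - v b"
  unfolding resistance_distance_def
  using assms unit_current_potential_drop_eq by (intro the_equality) blast+

text \<open>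
  Division by zero drops the terms with \<open>\<theta> i = 0\<close> from the sums over \<open>i\<close> below.
\<close>

lemma resistance_distance_spectral:
  fixes \<phi> :: "'i \<Rightarrow> 'a \<Rightarrow> real"
  assumes eigen: "\<And>i x. i \<in> I \<Longrightarrow> x \<in> pverts G \<Longrightarrow> laplacian G (\<phi> i) x = \<theta> i * \<phi> i x"
    and const: "\<And>i x y. i \<in> I \<Longrightarrow> \<theta> i = 0 \<Longrightarrow> x \<in> pverts G \<Longrightarrow> y \<in> pverts G \<Longrightarrow> \<phi> i x = \<phi> i y"
    and complete: "\<And>x y. x \<in> pverts G \<Longrightarrow> y \<in> pverts G \<Longrightarrow>
      (\<Sum>i\<in>I. \<phi> i x * \<phi> i y) = (if x = y then real (card (pverts G)) else 0)"
    and ab: "a \<in> pverts G" "b \<in> pverts G"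
  shows "resistance_distance G a b =
    (\<Sum>i\<in>I. (\<phi> i a - \<phi> i b)\<^sup>2 / \<theta> i) / real (card (pverts G))"
proof -
  define N where "N = real (card (pverts G))"
  have N: "N \<noteq> 0"
    using ab by (auto simp: N_def)
  \<comment> \<open>The pseudo-inverse of the Laplacian applied to the difference of the unit masses
    at \<open>a\<close> and \<open>b\<close>: expand that difference by \<open>complete\<close>,
    which brings in \<open>1 / N\<close>, and divide each coefficient by its eigenvalue.\<close>
  define v where "v x = (\<Sum>i\<in>I. (\<phi> i a - \<phi> i b) / (\<theta> i * N) * \<phi> i x)" for x
  have "laplacian G v x = (if x = a then 1 else 0) - (if x = b then 1 else 0)"
    if x: "x \<in> pverts G" for x
  proof -
    have "laplacian G v x = (\<Sum>i\<in>I. (\<phi> i a - \<phi> i b) / (\<theta> i * N) * laplacian G (\<phi> i) x)"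
      unfolding v_def by (simp only: laplacian_sum laplacian_scale)
    also have "\<dots> = (\<Sum>i\<in>I. (\<phi> i x * \<phi> i a - \<phi> i x * \<phi> i b) / N)"
    proof (rule sum.cong[OF refl])
      fix i assume i: "i \<in> I"
      \<comment> \<open>For \<open>\<theta> i = 0\<close> the left side is 0 by division by zero,
        and the right side is 0 because \<open>const\<close> gives
        \<open>\<phi> i a = \<phi> i b\<close>.\<close>
      show "(\<phi> i a - \<phi> i b) / (\<theta> i * N) * laplacian G (\<phi> i) x =
          (\<phi> i x * \<phi> i a - \<phi> i x * \<phi> i b) / N"
        using const[OF i _ ab] N by (cases "\<theta> i = 0") (auto simp: eigen[OF i x] field_simps)
    qed
    also have "\<dots> = ((\<Sum>i\<in>I. \<phi> i x * \<phi> i a) - (\<Sum>i\<in>I. \<phi> i x * \<phi> i b)) / N"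
      by (simp only: sum_divide_distrib sum_subtractf diff_divide_distrib)
    finally show ?thesis
      using N by (auto simp: complete[OF x ab(1)] complete[OF x ab(2)] N_def)
  qed
  then have "resistance_distance G a b = v a - v b"
    by (intro resistance_distance_eq ab) (simp add: unit_current_potential_iff)
  also have "\<dots> = (\<Sum>i\<in>I. (\<phi> i a - \<phi> i b)\<^sup>2 / \<theta> i) / N"
    unfolding v_def sum_subtractf[symmetric] sum_divide_distrib
    by (intro sum.cong refl)
       (simp add: power2_eq_square diff_divide_distrib add_divide_distrib algebra_simps)
  finally show ?thesis
    by (simp add: N_def)
qed

end

lemma sum_less_pairs:
  fixes r :: "'a::linorder \<Rightarrow> 'a \<Rightarrow> real"
  assumes fin: "finite V"
    and sym: "\<And>a b. a \<in> V \<Longrightarrow> b \<in> V \<Longrightarrow> r a b = r b a"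
    and diag: "\<And>a. a \<in> V \<Longrightarrow> r a a = 0"
  shows "(\<Sum>(a, b) | a \<in> V \<and> b \<in> V \<and> a < b. r a b) = (\<Sum>a\<in>V. \<Sum>b\<in>V. r a b) / 2"
proof -
  let ?L = "{(a, b). a \<in> V \<and> b \<in> V \<and> a < b}"
    and ?U = "{(a, b). a \<in> V \<and> b \<in> V \<and> b < a}" and ?D = "{(a, b). a \<in> V \<and> b \<in> V \<and> a = b}"
  have sub: "?L \<subseteq> V \<times> V" "?U \<subseteq> V \<times> V" "?D \<subseteq> V \<times> V"
    by auto
  have fins: "finite ?L" "finite ?U" "finite ?D"
    using fin by (auto intro: finite_subset[OF sub(1)] finite_subset[OF sub(2)]
      finite_subset[OF sub(3)])
  have "(\<Sum>a\<in>V. \<Sum>b\<in>V. r a b) = (\<Sum>(a, b)\<in>V \<times> V. r a b)"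
    by (simp add: sum.cartesian_product)
  also have "V \<times> V = ?L \<union> (?U \<union> ?D)"
    by auto
  also have "(\<Sum>(a, b)\<in>\<dots>. r a b) =
      (\<Sum>(a, b)\<in>?L. r a b) + ((\<Sum>(a, b)\<in>?U. r a b) + (\<Sum>(a, b)\<in>?D. r a b))"
    using fins by (subst sum.union_disjoint, auto)+
  also have "(\<Sum>(a, b)\<in>?D. r a b) = 0"
    by (rule sum.neutral) (auto simp: diag)
  also have "(\<Sum>(a, b)\<in>?U. r a b) = (\<Sum>(a, b)\<in>?L. r a b)"
    by (rule sum.reindex_bij_witness[of _ prod.swap prod.swap]) (auto simp: sym)
  finally show ?thesis
    by simp
qed

text \<open>Summed over all ordered pairs, the spectral formula for the resistance gives
  \<open>2 * N / \<theta> i\<close> for each \<open>i\<close>; unordered pairs account for half of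
  this.\<close>

lemma kirchhoff_index_spectral:
  fixes G :: "'a::linorder pair_pre_digraph" and \<phi> :: "'i \<Rightarrow> 'a \<Rightarrow> real"
  assumes "pair_graph G"
    and eigen: "\<And>i x. i \<in> I \<Longrightarrow> x \<in> pverts G \<Longrightarrow> laplacian G (\<phi> i) x = \<theta> i * \<phi> i x"
    and const: "\<And>i x y. i \<in> I \<Longrightarrow> \<theta> i = 0 \<Longrightarrow> x \<in> pverts G \<Longrightarrow> y \<in> pverts G \<Longrightarrow> \<phi> i x = \<phi> i y"
    and complete: "\<And>x y. x \<in> pverts G \<Longrightarrow> y \<in> pverts G \<Longrightarrow>
      (\<Sum>i\<in>I. \<phi> i x * \<phi> i y) = (if x = y then real (card (pverts G)) else 0)"
    and norm: "\<And>i. i \<in> I \<Longrightarrow> (\<Sum>x\<in>pverts G. (\<phi> i x)\<^sup>2) = real (card (pverts G))"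
  shows "kirchhoff_index G = real (card (pverts G)) * (\<Sum>i\<in>I. 1 / \<theta> i)"
proof -
  interpret pair_graph G by fact
  define V where "V = pverts G"
  define N where "N = real (card V)"
  note res = resistance_distance_spectral[of I \<phi> \<theta>, OF eigen const complete]
  have "kirchhoff_index G = (\<Sum>a\<in>V. \<Sum>b\<in>V. resistance_distance G a b) / 2"
    unfolding kirchhoff_index_def V_def
    by (rule sum_less_pairs) (auto simp: res power2_commute)
  also have "(\<Sum>a\<in>V. \<Sum>b\<in>V. resistance_distance G a b) =
      (\<Sum>a\<in>V. \<Sum>b\<in>V. \<Sum>i\<in>I. (\<phi> i a - \<phi> i b)\<^sup>2 / \<theta> i / N)"
    by (intro sum.cong refl) (simp add: res V_def N_def sum_divide_distrib)
  also have "\<dots> = (\<Sum>i\<in>I. \<Sum>a\<in>V. \<Sum>b\<in>V. (\<phi> i a - \<phi> i b)\<^sup>2 / \<theta> i / N)"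
    by (simp add: sum.swap[of _ I])
  also have "\<dots> = (\<Sum>i\<in>I. 2 * N / \<theta> i)"
  proof (rule sum.cong[OF refl])
    fix i assume i: "i \<in> I"
    show "(\<Sum>a\<in>V. \<Sum>b\<in>V. (\<phi> i a - \<phi> i b)\<^sup>2 / \<theta> i / N) = 2 * N / \<theta> i"
    proof (cases "\<theta> i = 0")
      case False
      \<comment> \<open>Pairing with the constant function 1, whose Laplacian is 0, shows that an
        eigenfunction with nonzero eigenvalue sums to 0.\<close>
      have "\<theta> i * (\<Sum>x\<in>V. \<phi> i x) = (\<Sum>x\<in>V. 1 * laplacian G (\<phi> i) x)"
        by (simp add: V_def eigen[OF i] sum_distrib_left)
      also have "\<dots> = 0"
        using laplacian_self_adjoint[of "\<lambda>_. 1" "\<phi> i"] by (simp add: V_def laplacian_def)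
      finally have mean: "(\<Sum>x\<in>V. \<phi> i x) = 0"
        using False by simp
      have "(\<Sum>a\<in>V. \<Sum>b\<in>V. (\<phi> i a - \<phi> i b)\<^sup>2) =
          (\<Sum>a\<in>V. \<Sum>b\<in>V. (\<phi> i a)\<^sup>2 + (\<phi> i b)\<^sup>2 - 2 * \<phi> i a * \<phi> i b)"
        by (simp add: power2_diff)
      \<comment> \<open>Each of the two square terms sums to \<open>N * N\<close> by
        \<open>norm\<close>; the cross term factors into sums that vanish by
        \<open>mean\<close>.\<close>
      also have "\<dots> = 2 * N * N"
        using norm[OF i] mean
        by (simp add: sum.distrib sum_subtractf flip: sum_distrib_left V_def)
           (simp add: V_def N_def flip: sum_distrib_left sum_distrib_right)
      finally show ?thesis
        using False by (cases "N = 0") (simp_all flip: sum_divide_distrib)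
    qed simp
  qed
  finally show ?thesis
    by (simp add: N_def V_def sum_divide_distrib sum_distrib_left)
qed

section \<open>Walsh characters\<close>

text \<open>\<open>U\<close> holds list positions counted from 0, so flipping the coordinate
  numbered \<open>i\<close> changes the sign exactly if \<open>i - 1 \<in> U\<close>.\<close>

definition walsh :: "nat set \<Rightarrow> bool list \<Rightarrow> real" where
  "walsh U x = (\<Prod>i\<in>U. if x ! i then -1 else 1)"

lemma walsh_square: "(walsh U x)\<^sup>2 = 1"
  by (auto simp: walsh_def prod_power_distrib intro: prod.neutral)

text \<open>The sum over \<open>U\<close> is the expansion of a product of factors
  \<open>?s i + 1\<close>, each 2 where \<open>x\<close> and \<open>y\<close> agree and 0 where they
  differ.\<close>

lemma sum_walsh_mult:
  assumes "length x = n" "length y = n"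
  shows "(\<Sum>U\<in>Pow {..<n}. walsh U x * walsh U y) = (if x = y then 2 ^ n else 0)"
proof -
  let ?s = "\<lambda>i. (if x ! i then -1 else 1) * (if y ! i then -1 else 1) :: real"
  have "(\<Sum>U\<in>Pow {..<n}. walsh U x * walsh U y) = (\<Sum>U\<in>Pow {..<n}. (\<Prod>i\<in>U. ?s i) * (\<Prod>i\<in>{..<n} - U. 1))"
    by (simp add: walsh_def prod.distrib)
  also have "\<dots> = (\<Prod>i<n. ?s i + 1)"
    by (rule prod_add[symmetric]) simp
  also have "\<dots> = (if x = y then 2 ^ n else 0)"
  proof (cases "x = y")
    case True
    then have "(\<Prod>i<n. ?s i + 1) = (\<Prod>i<n. 2)"
      by (intro prod.cong) auto
    with True show ?thesis by simp
  next
    case False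
    then obtain i where "i < n" "x ! i \<noteq> y ! i"
      using assms by (auto simp: list_eq_iff_nth_eq)
    with False show ?thesis
      by (auto intro!: prod_zero bexI[of _ i])
  qed
  finally show ?thesis .
qed

lemma walsh_flip_coord:
  assumes "U \<subseteq> {..<length x}" "1 \<le> i" "i \<le> length x"
  shows "walsh U (flip_coord i x) = (if i - 1 \<in> U then - walsh U x else walsh U x)"
proof -
  have fin: "finite U"
    using assms(1) finite_subset by blast
  have other: "(\<Prod>j\<in>U - {i - 1}. if flip_coord i x ! j then -1 else 1 :: real) =
      (\<Prod>j\<in>U - {i - 1}. if x ! j then -1 else 1)"
    by (intro prod.cong) (auto simp: flip_coord_def)
  show ?thesis
  proof (cases "i - 1 \<in> U")
    case True
    then show ?thesis
      using assms unfolding walsh_def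
      by (simp add: prod.remove[OF fin True] other) (auto simp: flip_coord_def)
  next
    case False
    then show ?thesis
      using other by (simp add: walsh_def)
  qed
qed

lemma walsh_flip_from:
  assumes U: "U \<subseteq> {..<length x}"
  shows "walsh U (flip_from k x) = (-1) ^ card (U \<inter> {k - 1..}) * walsh U x"
proof -
  have fin: "finite U"
    using U finite_subset by blast
  have "walsh U (flip_from k x) =
      (\<Prod>i\<in>U. (if i \<in> {k - 1..} then -1 else 1) * (if x ! i then -1 else 1))"
    unfolding walsh_def
  proof (rule prod.cong[OF refl])
    fix i assume "i \<in> U"
    with U have "i < length x" by auto
    then show "(if flip_from k x ! i then -1 else 1) =
        (if i \<in> {k - 1..} then -1 else 1) * (if x ! i then -1 else 1 :: real)"
      by (auto simp: flip_from_def nth_append)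
  qed
  also have "\<dots> = (\<Prod>i\<in>U. if i \<in> {k - 1..} then -1 else 1) * walsh U x"
    by (simp add: prod.distrib walsh_def)
  also have "(\<Prod>i\<in>U. if i \<in> {k - 1..} then -1 else 1 :: real) = (\<Prod>i\<in>U \<inter> {k - 1..}. -1)"
    by (rule prod.inter_restrict[OF fin, symmetric])
  finally show ?thesis
    by simp
qed

text \<open>A neighbour contributes \<open>2 * walsh U x\<close> if its generator reverses the sign
  of the character, and 0 otherwise. Rounding the second cardinality up to an even number accounts
  for the generator \<open>flip_from k\<close>.\<close>

lemma laplacian_walsh:
  assumes k: "1 \<le> k" "k < n" and x: "length x = n" and U: "U \<subseteq> {..<n}"
  shows "laplacian (enhanced_hypercube n k) (walsh U) x =
    2 * real (card (U \<inter> {..<k - 1}) + 2 * ((card (U \<inter> {k - 1..}) + 1) div 2)) * walsh U x"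
proof -
  have fin: "finite U"
    using U finite_subset by blast
  have inj: "inj_on (\<lambda>i. flip_coord i x) {1..n}"
  proof (rule inj_onI)
    fix i j assume ij: "i \<in> {1..n}" "j \<in> {1..n}" and eq: "flip_coord i x = flip_coord j x"
    have "i - 1 < length x"
      using ij x by auto
    then have "flip_coord i x ! (i - 1) \<noteq> x ! (i - 1)"
      by (simp add: flip_coord_def)
    then have "i - 1 = j - 1"
      unfolding eq by (metis flip_coord_def nth_list_update_neq)
    with ij show "i = j" by auto
  qed
  \<comment> \<open>Since \<open>k < n\<close>, \<open>flip_from k\<close> changes both positions
    \<open>k - 1\<close> and \<open>k\<close>, whereas \<open>flip_coord i\<close> changes only one.
    With \<open>inj\<close>, the \<open>n + 1\<close> neighbours are thus distinct and the sum over
    them splits.\<close>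
  have new: "flip_from k x \<notin> (\<lambda>i. flip_coord i x) ` {1..n}"
  proof
    assume "flip_from k x \<in> (\<lambda>i. flip_coord i x) ` {1..n}"
    then obtain i where i: "flip_from k x = flip_coord i x" by auto
    have "flip_from k x ! j \<noteq> x ! j" if "j \<in> {k - 1, k}" for j
      using that k x by (auto simp: flip_from_def nth_append min_def)
    then have "j = i - 1" if "j \<in> {k - 1, k}" for j
      using that unfolding i flip_coord_def by (metis nth_list_update_neq)
    then have "k - 1 = i - 1" "k = i - 1" by auto
    with k show False by simp
  qed
  have nbrs: "{y. (x, y) \<in> parcs (enhanced_hypercube n k)} =
      insert (flip_from k x) ((\<lambda>i. flip_coord i x) ` {1..n})"
    using x by (auto simp: enhanced_hypercube_def flip_coord_def flip_from_def)
  have "laplacian (enhanced_hypercube n k) (walsh U) x =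
      (walsh U x - walsh U (flip_from k x)) + (\<Sum>i = 1..n. walsh U x - walsh U (flip_coord i x))"
    unfolding laplacian_def nbrs using new inj by (simp add: sum.reindex)
  also have "(\<Sum>i = 1..n. walsh U x - walsh U (flip_coord i x)) =
      (\<Sum>i = 1..n. if i - 1 \<in> U then 2 * walsh U x else 0)"
    using U x by (intro sum.cong) (auto simp: walsh_flip_coord)
  also have "\<dots> = (\<Sum>i<n. if i \<in> U then 2 * walsh U x else 0)"
    by (rule sum.reindex_bij_witness[of _ Suc "\<lambda>i. i - 1"]) auto
  also have "\<dots> = 2 * real (card U) * walsh U x"
    using U by (simp add: Int_absorb1 flip: sum.inter_restrict)
  also have "card U = card (U \<inter> {..<k - 1}) + card (U \<inter> {k - 1..})"
    using fin by (subst card_Un_disjoint[symmetric]) (auto intro!: arg_cong[where f = card])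
  finally show ?thesis
    using U x
    by (cases "even (card (U \<inter> {k - 1..}))")
       (auto simp: walsh_flip_from algebra_simps elim!: evenE oddE)
qed

section \<open>Counting the eigenvalues\<close>

lemma sum_Pow_card:
  fixes f :: "nat \<Rightarrow> real"
  assumes "finite A"
  shows "(\<Sum>B\<in>Pow A. f (card B)) = (\<Sum>b\<le>card A. real (card A choose b) * f b)"
proof -
  have "(\<Sum>B\<in>Pow A. f (card B)) = (\<Sum>b\<le>card A. \<Sum>B\<in>{B \<in> Pow A. card B = b}. f (card B))"
    using assms by (intro sum.group[symmetric]) (auto intro: card_mono)
  also have "\<dots> = (\<Sum>b\<le>card A. real (card A choose b) * f b)"
    using n_subsets[OF assms] by (intro sum.cong) auto
  finally show ?thesis .
qed

lemma sum_Pow_Un_disjoint: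
  assumes "A \<inter> B = {}"
  shows "(\<Sum>U\<in>Pow (A \<union> B). g (U \<inter> A) (U \<inter> B)) = (\<Sum>X\<in>Pow A. \<Sum>Y\<in>Pow B. g X Y)"
  unfolding sum.cartesian_product
  by (rule sum.reindex_bij_witness[of _ "\<lambda>(X, Y). X \<union> Y" "\<lambda>U. (U \<inter> A, U \<inter> B)"])
     (use assms in \<open>auto simp: Int_Un_distrib2 Un_Int_distrib Int_absorb2\<close>)

lemma sum_choose_round_up:
  fixes g :: "nat \<Rightarrow> real"
  assumes "m \<le> 2 * n"
  shows "(\<Sum>b\<le>m. real (m choose b) * g (2 * ((b + 1) div 2))) =
    (\<Sum>j\<le>n. real (Suc m choose (2 * j)) * g (2 * j))"
proof -
  have "(\<Sum>b\<le>m. real (m choose b) * g (2 * ((b + 1) div 2))) =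
      (\<Sum>b\<le>2 * n. real (m choose b) * g (2 * ((b + 1) div 2)))"
    using assms by (intro sum.mono_neutral_left) (auto simp: not_le)
  \<comment> \<open>The induction step adds \<open>b = 2 * n + 1\<close> and
    \<open>b = 2 * n + 2\<close>, which both round up to \<open>2 * n + 2\<close>; Pascal's rule
    joins their coefficients.\<close>
  also have "\<dots> = (\<Sum>j\<le>n. real (Suc m choose (2 * j)) * g (2 * j))"
    by (induction n) (simp_all add: algebra_simps)
  finally show ?thesis .
qed

lemma binom_of_nat: "binom (int a) (int b) = a choose b"
  by (simp add: binom_def)

lemma binom_eq_choose: "int a = i \<Longrightarrow> int b = j \<Longrightarrow> binom i j = a choose b"
  using binom_of_nat by auto

text \<open>Reindexing by \<open>s = a + c\<close> and then \<open>t = s - 1\<close> collects the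
  terms by the argument of \<open>f\<close>.\<close>

lemma sum_choose_shift:
  fixes f :: "nat \<Rightarrow> real"
  assumes "f 0 = 0" "h + c \<le> Suc n"
  shows "(\<Sum>a\<le>h. real (h choose a) * f (a + c)) =
    (\<Sum>t = 0..n. f (t + 1) * real (binom (int h) (int t + 1 - int c)))"
proof -
  have "(\<Sum>a\<le>h. real (h choose a) * f (a + c)) =
      (\<Sum>s\<in>{c..h + c}. f s * real (binom (int h) (int s - int c)))"
    by (rule sum.reindex_bij_witness[of _ "\<lambda>s. s - c" "\<lambda>a. a + c"]) (auto simp: binom_of_nat)
  \<comment> \<open>Outside \<open>{c..h + c}\<close> the coefficient is 0; for \<open>s < c\<close>
    this relies on the negative lower index of \<open>binom\<close>.\<close>
  also have "\<dots> = (\<Sum>s\<in>{..Suc n}. f s * real (binom (int h) (int s - int c)))"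
    using assms(2) by (intro sum.mono_neutral_left) (auto simp: binom_def)
  also have "\<dots> = (\<Sum>t\<in>{..n}. f (t + 1) * real (binom (int h) (int t + 1 - int c)))"
    unfolding sum.atMost_Suc_shift using assms(1) by (simp add: algebra_simps)
  finally show ?thesis
    by (simp add: atLeast0AtMost)
qed

text \<open>Collects the subsets by half their eigenvalue, \<open>t + 1\<close>. The condition
  \<open>f 0 = 0\<close> discards the empty set, which alone has eigenvalue 0.\<close>

lemma sum_subsets_eigenvalue:
  fixes f :: "nat \<Rightarrow> real"
  assumes k: "1 \<le> k" "k < n" and f0: "f 0 = 0"
  shows "(\<Sum>U\<in>Pow {..<n}. f (card (U \<inter> {..<k - 1}) + 2 * ((card (U \<inter> {k - 1..}) + 1) div 2))) =
    (\<Sum>t = 0..n. \<Sum>j = 0..n. f (t + 1) * real (binom (int n - int k + 2) (2 * int j))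
              * real (binom (int k - 1) (int t + 1 - 2 * int j)))"
proof -
  let ?A = "{..<k - 1}" and ?B = "{k - 1..<n}"
  define m where "m = n - k + 1"
  define h where "h = k - 1"
  have un: "{..<n} = ?A \<union> ?B"
    using k by auto
  have cards: "card ?A = h" "card ?B = m"
    using k by (auto simp: h_def m_def)
  have "(\<Sum>U\<in>Pow {..<n}. f (card (U \<inter> ?A) + 2 * ((card (U \<inter> {k - 1..}) + 1) div 2))) =
      (\<Sum>U\<in>Pow (?A \<union> ?B). f (card (U \<inter> ?A) + 2 * ((card (U \<inter> ?B) + 1) div 2)))"
    unfolding un[symmetric]
  proof (rule sum.cong[OF refl])
    fix U assume "U \<in> Pow {..<n}"
    then have "U \<inter> {k - 1..} = U \<inter> ?B" by auto
    then show "f (card (U \<inter> ?A) + 2 * ((card (U \<inter> {k - 1..}) + 1) div 2)) =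
        f (card (U \<inter> ?A) + 2 * ((card (U \<inter> ?B) + 1) div 2))" by simp
  qed
  also have "\<dots> = (\<Sum>X\<in>Pow ?A. \<Sum>Y\<in>Pow ?B. f (card X + 2 * ((card Y + 1) div 2)))"
    by (rule sum_Pow_Un_disjoint) auto
  also have "\<dots> = (\<Sum>X\<in>Pow ?A. \<Sum>b\<le>m. real (m choose b) * f (card X + 2 * ((b + 1) div 2)))"
    unfolding cards(2)[symmetric]
      sum_Pow_card[of ?B "\<lambda>b. f (card X + 2 * ((b + 1) div 2))" for X, OF finite_atLeastLessThan] ..
  also have "\<dots> = (\<Sum>X\<in>Pow ?A. \<Sum>j\<le>n. real (Suc m choose (2 * j)) * f (card X + 2 * j))"
    using k by (intro sum.cong refl sum_choose_round_up) (auto simp: m_def)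
  also have "\<dots> = (\<Sum>j\<le>n. real (Suc m choose (2 * j)) * (\<Sum>X\<in>Pow ?A. f (card X + 2 * j)))"
    by (subst sum.swap) (simp add: sum_distrib_left)
  also have "\<dots> = (\<Sum>j\<le>n. real (Suc m choose (2 * j)) *
      (\<Sum>t = 0..n. f (t + 1) * real (binom (int h) (int t + 1 - int (2 * j)))))"
  proof (rule sum.cong[OF refl])
    fix j
    show "real (Suc m choose (2 * j)) * (\<Sum>X\<in>Pow ?A. f (card X + 2 * j)) =
      real (Suc m choose (2 * j)) *
      (\<Sum>t = 0..n. f (t + 1) * real (binom (int h) (int t + 1 - int (2 * j))))"
    \<comment> \<open>As \<open>h + m = n\<close>, this case gives
      \<open>h + 2 * j \<le> Suc n\<close>, so letting \<open>t\<close> run up to \<open>n\<close>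
      reaches every term. Otherwise the outer coefficient is 0.\<close>
    proof (cases "2 * j \<le> Suc m")
      case True
      then have "h + 2 * j \<le> Suc n"
        using k by (simp add: h_def m_def)
      then show ?thesis
        using sum_Pow_card[of ?A "\<lambda>a. f (a + 2 * j)", unfolded cards]
          sum_choose_shift[of f h "2 * j" n] f0
        by simp
    qed (simp add: binomial_eq_0)
  qed
  also have "\<dots> = (\<Sum>t = 0..n. \<Sum>j = 0..n. f (t + 1) * real (Suc m choose (2 * j)) *
      real (binom (int h) (int t + 1 - int (2 * j))))"
    unfolding sum_distrib_left by (subst sum.swap) (simp add: atLeast0AtMost algebra_simps)
  also have "\<dots> = (\<Sum>t = 0..n. \<Sum>j = 0..n. f (t + 1) * real (binom (int n - int k + 2) (2 * int j))
              * real (binom (int k - 1) (int t + 1 - 2 * int j)))"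
  proof -
    have "binom (int n - int k + 2) (2 * int j) = Suc m choose (2 * j)" for j
      using k by (intro binom_eq_choose) (auto simp: m_def)
    moreover have "int h = int k - 1"
      using k by (simp add: h_def)
    ultimately show ?thesis by simp
  qed
  finally show ?thesis .
qed

theorem theorem4:
  fixes n k :: nat
  assumes "n \<ge> 2" and "1 \<le> k" and "k \<le> n - 1"
  shows "kirchhoff_index (enhanced_hypercube n k) =
    (if [n = k] (mod 2)
     then 2 ^ (n - 1) * (\<Sum>t = 0..n. \<Sum>j = 0..n.
            1 / (real t + 1) * real (binom (int n - int k + 2) (2 * int j))
              * real (binom (int k - 1) (int t + 1 - 2 * int j)))
     else 2 ^ (n - 1) * (\<Sum>t = 0..n - 1. \<Sum>j = 0..n.
            1 / (real t + 1) * real (binom (int n - int k + 2) (2 * int j))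
              * real (binom (int k - 1) (int t + 1 - 2 * int j))))"
proof -
  let ?G = "enhanced_hypercube n k"
  let ?s = "\<lambda>U. card (U \<inter> {..<k - 1}) + 2 * ((card (U \<inter> {k - 1..}) + 1) div 2)"
  let ?T = "\<lambda>t. \<Sum>j = 0..n. 1 / (real t + 1) * real (binom (int n - int k + 2) (2 * int j))
              * real (binom (int k - 1) (int t + 1 - 2 * int j))"
  have k: "1 \<le> k" "k < n"
    using assms by auto
  have verts: "pverts ?G = {x. length x = n}"
    by (simp add: enhanced_hypercube_def)
  have card_verts: "card (pverts ?G) = 2 ^ n"
    using card_lists_length_eq[of "UNIV :: bool set" n] by (simp add: verts)
  have "kirchhoff_index ?G = real (card (pverts ?G)) * (\<Sum>U\<in>Pow {..<n}. 1 / (2 * real (?s U)))"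
  proof (rule kirchhoff_index_spectral)
    show "pair_graph ?G"
      using k by (intro pair_graph_enhanced_hypercube) auto
    show "laplacian ?G (walsh U) x = 2 * real (?s U) * walsh U x"
      if "U \<in> Pow {..<n}" "x \<in> pverts ?G" for U x
      using that k by (intro laplacian_walsh) (auto simp: verts)
    \<comment> \<open>The eigenvalue is 0 only if both cardinalities are 0, that is for
      \<open>U = {}\<close>, whose character is constantly 1.\<close>
    show "walsh U x = walsh U y" if U: "U \<in> Pow {..<n}" and s: "2 * real (?s U) = 0" for U x y
    proof -
      have "finite U"
        using U finite_subset by auto
      moreover have "?s U = 0"
        using s unfolding mult_eq_0_iff of_nat_eq_0_iff by simp
      then have "card (U \<inter> {..<k - 1}) = 0" "card (U \<inter> {k - 1..}) = 0"
        by presburger+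
      ultimately have "(U \<inter> {..<k - 1}) \<union> (U \<inter> {k - 1..}) = {}"
        by simp
      also have "(U \<inter> {..<k - 1}) \<union> (U \<inter> {k - 1..}) = U"
        by auto
      finally have "U = {}" .
      then show ?thesis by (simp add: walsh_def)
    qed
    show "(\<Sum>U\<in>Pow {..<n}. walsh U x * walsh U y) = (if x = y then real (card (pverts ?G)) else 0)"
      if "x \<in> pverts ?G" "y \<in> pverts ?G" for x y
      using that unfolding card_verts by (simp add: verts sum_walsh_mult)
    show "(\<Sum>x\<in>pverts ?G. (walsh U x)\<^sup>2) = real (card (pverts ?G))" for U
      by (simp add: walsh_square)
  qed
  also have "\<dots> = 2 ^ (n - 1) * (\<Sum>U\<in>Pow {..<n}. 1 / real (?s U))"
  proof -
    have "(2::real) ^ n = 2 ^ (n - 1) * 2"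
      using k by (simp flip: power_Suc2)
    moreover have "(\<Sum>U\<in>Pow {..<n}. 1 / (2 * real (?s U))) = (\<Sum>U\<in>Pow {..<n}. 1 / real (?s U)) / 2"
      unfolding sum_divide_distrib by (simp only: divide_divide_eq_left mult.commute)
    ultimately show ?thesis
      unfolding card_verts by simp
  qed
  \<comment> \<open>The function \<open>1 / real s\<close> is 0 at \<open>s = 0\<close> by division
    by zero, as the counting lemma demands.\<close>
  also have "(\<Sum>U\<in>Pow {..<n}. 1 / real (?s U)) = (\<Sum>t = 0..n. ?T t)"
    using sum_subsets_eigenvalue[OF k, of "\<lambda>s. 1 / real s"] by (simp add: add.commute)
  finally have main: "kirchhoff_index ?G = 2 ^ (n - 1) * (\<Sum>t = 0..n. ?T t)" .
  show ?thesis
  proof (cases "[n = k] (mod 2)")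
    case False
    \<comment> \<open>A nonzero term at \<open>t = n\<close> needs
      \<open>2 * j \<le> n - k + 2\<close> for the first coefficient and
      \<open>n + 1 - 2 * j \<le> k - 1\<close> for the second, hence
      \<open>2 * j = n - k + 2\<close>, which the parity excludes.\<close>
    have "?T n = 0"
    proof (rule sum.neutral, rule ballI)
      fix j
      have "int n - int k + 2 \<noteq> 2 * int j"
        using False k unfolding cong_def by presburger
      then have "binom (int n - int k + 2) (2 * int j) = 0 \<or>
          binom (int k - 1) (int n + 1 - 2 * int j) = 0"
        by (auto simp: binom_def)
      then show "1 / (real n + 1) * real (binom (int n - int k + 2) (2 * int j))
              * real (binom (int k - 1) (int n + 1 - 2 * int j)) = 0" by auto
    qed
    moreover have "(\<Sum>t = 0..n. ?T t) = (\<Sum>t = 0..n - 1. ?T t) + ?T n"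
      using k sum.atLeast0_atMost_Suc[of ?T "n - 1"] by simp
    ultimately show ?thesis
      using main False by simp
  qed (use main in simp)
qed

end
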